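(* Let $r>s>0$ be integers and $\underline{x}=(x_2,\ldots,x_r)$ a tuple of elements of $\{0,1\}$. Consider any $\Phi$-irreducible element $w\in\Gamma_{\underline{x}}$. Let $i_1,\ldots,i_k$ be the distinct elements of $J_w$ in any order. Then $w$ is conjugate to $a_{i_1}\cdots a_{i_k}$ under $W$.
   Context: Let $T$ be the infinite rooted regular binary tree whose vertices are the finite words over $\{0,1\}$, with root the empty word, each word $t$ being joined by an edge to the words $0t$ and $1t$. Level $n$ of $T$ is the set of words of length $n$. Let $W=\mathrm{Aut}(T)$ be the automorphism group of $T$ (products are compositions, $(uv)(t)=u(v(t))$), with identity element $1$. For $u,v\in W$, let $(u,v)\in W$ be the automorphism fixing the root and given by $t0\mapsto u(t)0$ and $t1\mapsto v(t)1$ for every word $t$. Let $\sigma\in W$ be the involution fixing the root with $t0\mapsto t1$ and $t1\mapsto t0$ for every word $t$. Then $W=(W\times W)\rtimes\langle\sigma\rangle$, so every $w\in W$ can be written uniquely as $(u,v)$ or as $(u,v)\,\sigma$. The first descendants of $w\in W$ are the elements $u$ and $v$ if $w=(u,v)$, respectively the single element $uv$ if $w=(u,v)\,\sigma$. For $n\ge1$, the first descendants of the $n$-th descendants of $w$ are the $(n+1)$-st descendants of $w$. $\mathrm{Desc}(w)$ is the set of all $n$-th descendants of $w$ for all $n\ge1$. An element $w$ is called $\Phi$-irreducible if $\mathrm{Desc}(w)$ is finite and $w\in\mathrm{Desc}(w)$. Let $b_1,\ldots,b_r\in W$ be the elements determined by the recursion relations $b_1=\sigma$; $b_{s+1}=(b_r,b_s)$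 if $x_{s+1}=0$; $b_{s+1}=(b_s,b_r)$ if $x_{s+1}=1$; $b_i=(b_{i-1},1)$ for all $i\ne1,s+1$ with $x_i=0$; $b_i=(1,b_{i-1})$ for all $i\neq1,s+1$ with $x_i=1$. Let $\Gamma_{\underline{x}}\subset W$ be the subgroup generated by $b_1,\ldots,b_r$. Let $a_1,\ldots,a_r\in W$ be the elements determined by the recursion relations $a_1=\sigma$, $a_{s+1}=(a_r,a_s)$, and $a_i=(a_{i-1},1)$ for all $i\ne1,s+1$. For $w\in W$ and $n\ge 0$ let $\mathrm{sgn}_n(w)\in\{\pm1\}$ be the sign of the permutation of level $n$ induced by $w$, and for $w\in\Gamma_{\underline{x}}$ set $J_w:=\{1\le i\le r\mid\mathrm{sgn}_i(w)=-1\}$. *)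

theory Defs
  imports "HOL-Algebra.Generated_Groups" "HOL-Combinatorics.Permutations"
begin

(* The letters 0 and 1 are the booleans False and True.  A vertex is joined to its children by
   prepending a letter, so the letter of a word closest to the root is its last one. *)
type_synonym vertex = "bool list"

definition tree_adj :: "vertex \<Rightarrow> vertex \<Rightarrow> bool" where
  "tree_adj t t' \<longleftrightarrow> (\<exists>c. t' = c # t) \<or> (\<exists>c. t = c # t')"

definition W :: "(vertex \<Rightarrow> vertex) monoid" where
  "W = \<lparr>carrier = {f. bij f \<and> f [] = [] \<and> (\<forall>t t'. tree_adj (f t) (f t') \<longleftrightarrow> tree_adj t t')},
        monoid.mult = (\<circ>), one = id\<rparr>"

definition pair :: "(vertex \<Rightarrow> vertex) \<Rightarrow> (vertex \<Rightarrow> vertex) \<Rightarrow> vertex \<Rightarrow> vertex" where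
  "pair u v t =
    (if t = [] then [] else (if last t then v (butlast t) else u (butlast t)) @ [last t])"

definition swap :: "vertex \<Rightarrow> vertex" where
  "swap t = (if t = [] then [] else butlast t @ [\<not> last t])"

definition first_desc :: "(vertex \<Rightarrow> vertex) \<Rightarrow> (vertex \<Rightarrow> vertex) set" where
  "first_desc w =
    {d. \<exists>u\<in>carrier W. \<exists>v\<in>carrier W.
          (w = pair u v \<and> (d = u \<or> d = v)) \<or> (w = pair u v \<circ> swap \<and> d = u \<circ> v)}"

primrec nth_desc :: "nat \<Rightarrow> (vertex \<Rightarrow> vertex) \<Rightarrow> (vertex \<Rightarrow> vertex) set" where
  "nth_desc 0 w = {w}"
| "nth_desc (Suc n) w = (\<Union>v\<in>nth_desc n w. first_desc v)"

definition Desc :: "(vertex \<Rightarrow> vertex) \<Rightarrow> (vertex \<Rightarrow> vertex) set" where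
  "Desc w = (\<Union>n\<in>{1..}. nth_desc n w)"

definition Phi_irreducible :: "(vertex \<Rightarrow> vertex) \<Rightarrow> bool" where
  "Phi_irreducible w \<longleftrightarrow> finite (Desc w) \<and> w \<in> Desc w"

(* Only x 2, ..., x r matter. As shown below, these relations have a solution, which is unique
   on {1..r}; the same holds for a_recursion, the case where all x i are 0. *)
definition b_recursion ::
    "nat \<Rightarrow> nat \<Rightarrow> (nat \<Rightarrow> bool) \<Rightarrow> (nat \<Rightarrow> vertex \<Rightarrow> vertex) \<Rightarrow> bool" where
  "b_recursion r s x b \<longleftrightarrow>
    (\<forall>i\<in>{1..r}. b i \<in> carrier W) \<and>
    b 1 = swap \<and>
    b (s + 1) = (if x (s + 1) then pair (b s) (b r) else pair (b r) (b s)) \<and>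
    (\<forall>i\<in>{2..r} - {s + 1}. b i = (if x i then pair id (b (i - 1)) else pair (b (i - 1)) id))"

definition a_recursion :: "nat \<Rightarrow> nat \<Rightarrow> (nat \<Rightarrow> vertex \<Rightarrow> vertex) \<Rightarrow> bool" where
  "a_recursion r s a \<longleftrightarrow>
    (\<forall>i\<in>{1..r}. a i \<in> carrier W) \<and>
    a 1 = swap \<and>
    a (s + 1) = pair (a r) (a s) \<and>
    (\<forall>i\<in>{2..r} - {s + 1}. a i = pair (a (i - 1)) id)"

definition level_sgn :: "nat \<Rightarrow> (vertex \<Rightarrow> vertex) \<Rightarrow> int" where
  "level_sgn n w = sign_on {t. length t = n} w"

definition J :: "nat \<Rightarrow> (vertex \<Rightarrow> vertex) \<Rightarrow> nat set" where
  "J r w = {i \<in> {1..r}. level_sgn i w = - 1}"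


lemma pair_simps [simp]:
  "pair u v [] = []"
  "pair u v (t @ [c]) = (if c then v t else u t) @ [c]"
  by (simp_all add: pair_def)

lemma swap_simps [simp]:
  "swap [] = []"
  "swap (t @ [c]) = t @ [\<not> c]"
  by (simp_all add: swap_def)

lemma W_simps [simp]: "monoid.mult W = (\<circ>)" "one W = id"
  by (simp_all add: W_def)

lemma W_iff:
  "f \<in> carrier W \<longleftrightarrow> bij f \<and> f [] = [] \<and> (\<forall>t t'. tree_adj (f t) (f t') \<longleftrightarrow> tree_adj t t')"
  by (simp add: W_def)

lemma group_W: "group W"
proof (rule groupI)
  fix f assume f: "f \<in> carrier W"
  have "inv_into UNIV f \<in> carrier W"
    using f unfolding W_iff
    by (metis bij_imp_bij_inv bij_inv_eq_iff)
  moreover have "inv_into UNIV f \<circ> f = id"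
    using f by (simp add: W_iff bij_is_inj)
  ultimately show "\<exists>g\<in>carrier W. g \<otimes>\<^bsub>W\<^esub> f = \<one>\<^bsub>W\<^esub>"
    by auto
qed (auto simp: W_iff bij_comp)

lemma W_I:
  assumes "bij f" "f [] = []" and child: "\<And>c t. \<exists>d. f (c # t) = d # f t"
  shows "f \<in> carrier W"
proof -
  have eq: "f t = f t' \<longleftrightarrow> t = t'" for t t'
    using assms(1) by (metis bij_is_inj injD)
  have *: "(\<exists>d. f t' = d # f t) \<longleftrightarrow> (\<exists>c. t' = c # t)" for t t'
  proof
    assume "\<exists>d. f t' = d # f t"
    then obtain d where d: "f t' = d # f t" ..
    then obtain c t'' where t': "t' = c # t''"
      using assms(2) by (cases t') auto
    obtain e where "f t' = e # f t''"
      using child t' by blast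
    with d eq have "t'' = t" by simp
    with t' show "\<exists>c. t' = c # t" by blast
  qed (use child in blast)
  show ?thesis
    using assms by (simp add: W_iff tree_adj_def *)
qed

text \<open>The recursion relations determine the generators: a solution exists, and any two agree.\<close>

fun b_aux :: "nat \<Rightarrow> nat \<Rightarrow> (nat \<Rightarrow> bool) \<Rightarrow> nat \<Rightarrow> bool list \<Rightarrow> bool list" where
  "b_aux r s x i [] = []"
| "b_aux r s x i (c # t) =
    (if i = 1 then (\<not> c) # t
     else if i = s + 1 then c # b_aux r s x (if c = x i then r else s) t
     else if c = x i then c # b_aux r s x (i - 1) t
     else c # t)"

lemma b_aux_append: "\<exists>d. b_aux r s x i (t @ [c]) = b_aux r s x i t @ [d]"
  by (induction t arbitrary: i) auto

lemma b_aux_inj: "b_aux r s x i t = b_aux r s x i t' \<Longrightarrow> t = t'"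
proof (induction t arbitrary: i t')
  case Nil
  then show ?case by (cases t') (auto split: if_splits)
next
  case (Cons c t)
  then obtain c' t'' where "t' = c' # t''"
    by (cases t') (auto split: if_splits)
  with Cons show ?case by (auto split: if_splits)
qed

lemma b_aux_surj: "\<exists>t'. b_aux r s x i t' = t"
proof (induction t arbitrary: i)
  case Nil
  show ?case by (rule exI[of _ "[]"]) simp
next
  case (Cons c t)
  show ?case
  proof (cases "i = 1")
    case True
    then show ?thesis by (intro exI[of _ "(\<not> c) # t"]) simp
  next
    case i: False
    show ?thesis
    proof (cases "i \<noteq> s + 1 \<and> c \<noteq> x i")
      case True
      with i show ?thesis by (intro exI[of _ "c # t"]) simp
    next
      case False
      obtain t' where "b_aux r s x
          (if i = s + 1 then (if c = x i then r else s) else i - 1) t' = t"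
        using Cons by blast
      with i False show ?thesis
        by (intro exI[of _ "c # t'"]) (auto split: if_splits)
    qed
  qed
qed

lemma b_aux_W: "(\<lambda>t. rev (b_aux r s x i (rev t))) \<in> carrier W"
proof (rule W_I)
  show "bij (\<lambda>t. rev (b_aux r s x i (rev t)))"
  proof (rule bijI)
    show "inj (\<lambda>t. rev (b_aux r s x i (rev t)))"
      by (rule injI) (metis b_aux_inj rev_rev_ident)
    show "surj (\<lambda>t. rev (b_aux r s x i (rev t)))"
      by (rule surjI[where f = "\<lambda>t. rev (SOME t'. b_aux r s x i t' = rev t)"])
        (simp add: someI_ex[OF b_aux_surj])
  qed
  show "\<exists>d. rev (b_aux r s x i (rev (c # t))) = d # rev (b_aux r s x i (rev t))" for c t
    using b_aux_append[of r s x i "rev t" c] by auto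
qed simp

lemma ext_snoc:
  assumes "f [] = g []" "\<And>t c. f (t @ [c]) = g (t @ [c])"
  shows "f = (g :: vertex \<Rightarrow> vertex)"
  by (rule ext) (metis assms rev_exhaust)

lemma b_recursion_exists:
  assumes "0 < s" "s < r"
  shows "\<exists>b. b_recursion r s x b"
proof
  let ?b = "\<lambda>i t. rev (b_aux r s x i (rev t))"
  have "?b 1 = swap"
    by (rule ext_snoc) auto
  moreover have "?b (s + 1) = (if x (s + 1) then pair (?b s) (?b r) else pair (?b r) (?b s))"
    using assms by (intro ext_snoc) auto
  moreover have "?b i = (if x i then pair id (?b (i - 1)) else pair (?b (i - 1)) id)"
    if "i \<in> {2..r} - {s + 1}" for i
    using that by (intro ext_snoc) auto
  ultimately show "b_recursion r s x ?b"
    unfolding b_recursion_def using b_aux_W by simp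
qed

lemma b_recursion_unique:
  assumes "0 < s" "s < r" "b_recursion r s x b" "b_recursion r s x b'" "i \<in> {1..r}"
  shows "b i = b' i"
proof
  fix t
  show "b i t = b' i t"
    using assms(5)
  proof (induction t arbitrary: i rule: rev_induct)
    case Nil
    then show ?case
      using assms(3,4) by (auto simp: b_recursion_def W_iff)
  next
    case (snoc c t)
    have r: "b r t = b' r t" and s: "b s t = b' s t"
      using assms(1,2) by (auto intro: snoc.IH)
    consider "i = 1" | "i = s + 1" | "i \<in> {2..r} - {s + 1}"
      using snoc.prems by fastforce
    then show ?case
    proof cases
      case 3
      then have "b (i - 1) t = b' (i - 1) t"
        by (intro snoc.IH) auto
      moreover have "b i = (if x i then pair id (b (i - 1)) else pair (b (i - 1)) id)"
        and "b' i = (if x i then pair id (b' (i - 1)) else pair (b' (i - 1)) id)"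
        using assms(3,4) 3 unfolding b_recursion_def by blast+
      ultimately show ?thesis by simp
    qed (use assms(3,4) r s in \<open>auto simp: b_recursion_def\<close>)
  qed
qed

lemma a_recursion_eq: "a_recursion r s a \<longleftrightarrow> b_recursion r s (\<lambda>_. False) a"
  by (simp add: a_recursion_def b_recursion_def)

end

theory Submission
  imports Defs
begin

text \<open>
  Two automorphisms of the tree are conjugate as soon as their trees of descendants match, so it is
  enough to match the descendants of \<open>w\<close> with those of a product of distinct \<open>a\<^sub>i\<close>. Write the
  elements of an orbit \<open>w = w\<^sub>0, w\<^sub>1, \<dots>, w\<^sub>n = w\<close> of successive descendants as words in the
  generators, starting from a word for \<open>w\<close> with as few letters \<open>> s\<close> as possible. Descent never
  creates such letters, so by minimality none of them ever leaves the orbit. Every letter \<open>\<le> s\<close> is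
  born as the letter \<open>s\<close> from an \<open>s + 1\<close>, and remains on the orbit at birth only if \<open>\<sigma>\<close> occurs an
  odd number of times at that step. As a \<open>\<sigma>\<close> is a letter born \<open>s\<close> steps earlier, the set of
  swapping steps is invariant under the shift by \<open>s\<close>, by periodicity in both directions. Hence no
  small letter can leave the orbit before it has become a \<open>\<sigma>\<close>, and at each step \<open>w\<^sub>t = (u, v)\<close> the
  component off the orbit is just \<open>b\<^sub>s\<close> or \<open>1\<close>, depending on the parity of the letter \<open>s + 1\<close>. This is
  how the product of the \<open>a\<^sub>i\<close> behaves, the parities of the letters being read off from the signs.
\<close>

section \<open>The automorphism group of the tree\<close>

lemma W_adj: "f \<in> carrier W \<Longrightarrow> tree_adj t t' \<Longrightarrow> tree_adj (f t) (f t')"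
  by (simp add: W_iff)

text \<open>The image of a child of \<open>t\<close> is adjacent to \<open>f t\<close>, and
  injectivity rules out the neighbour of \<open>f t\<close> towards the root, which is the image of
  the parent of \<open>t\<close>.\<close>

lemma W_child:
  assumes "f \<in> carrier W"
  shows "\<exists>d. f (c # t) = d # f t"
proof (induction t arbitrary: c)
  case Nil
  have "tree_adj (f [c]) (f [])"
    by (rule W_adj[OF assms]) (simp add: tree_adj_def)
  moreover have "f [] = []"
    using assms by (simp add: W_iff)
  ultimately show ?case
    unfolding tree_adj_def by auto
next
  case (Cons e t)
  have "tree_adj (f (c # e # t)) (f (e # t))"
    by (rule W_adj[OF assms]) (simp add: tree_adj_def)
  moreover have "inj f"
    using assms by (simp add: W_iff bij_is_inj)
  then have "f (c # e # t) \<noteq> f t"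
    by (simp add: inj_eq)
  moreover obtain d where "f (e # t) = d # f t"
    using Cons.IH by blast
  ultimately show ?case
    unfolding tree_adj_def by (metis list.inject)
qed

lemma W_length:
  assumes "f \<in> carrier W"
  shows "length (f t) = length t"
proof (induction t)
  case (Cons c t)
  with W_child[OF assms, of c t] show ?case by auto
qed (use assms in \<open>simp add: W_iff\<close>)

lemma id_in_W: "id \<in> carrier W"
  using group.is_monoid[OF group_W] monoid.one_closed by fastforce

lemma comp_in_W: "f \<in> carrier W \<Longrightarrow> g \<in> carrier W \<Longrightarrow> f \<circ> g \<in> carrier W"
  using group.is_monoid[OF group_W] monoid.m_closed by fastforce

lemma inv_in_W:
  assumes "f \<in> carrier W"
  shows "inv\<^bsub>W\<^esub> f \<in> carrier W" "(inv\<^bsub>W\<^esub> f) (f t) = t" "f ((inv\<^bsub>W\<^esub> f) t) = t"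
proof -
  show "inv\<^bsub>W\<^esub> f \<in> carrier W"
    using group.inv_closed[OF group_W assms] .
  show "(inv\<^bsub>W\<^esub> f) (f t) = t"
    using group.l_inv[OF group_W assms] by (metis W_simps comp_apply id_apply)
  show "f ((inv\<^bsub>W\<^esub> f) t) = t"
    using group.r_inv[OF group_W assms] by (metis W_simps comp_apply id_apply)
qed

lemma pair_in_W:
  assumes "u \<in> carrier W" "v \<in> carrier W"
  shows "pair u v \<in> carrier W"
proof (rule W_I)
  let ?p = "pair u v" and ?q = "pair (inv\<^bsub>W\<^esub> u) (inv\<^bsub>W\<^esub> v)"
  have "?p (?q t) = t" "?q (?p t) = t" for t
    by (cases t rule: rev_cases; simp add: inv_in_W assms)+
  then show "bij ?p"
    by (metis bij_iff)
  show "\<exists>d. ?p (c # t) = d # ?p t" for c t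
  proof (cases t rule: rev_cases)
    case Nil
    then show ?thesis
      using assms pair_simps(2)[of u v "[]" c] by (simp add: W_iff)
  next
    case (snoc t' e)
    with W_child[OF assms(1), of c t'] W_child[OF assms(2), of c t'] show ?thesis
      using pair_simps(2)[of u v "c # t'" e] by auto
  qed
qed simp

lemma swap_in_W: "swap \<in> carrier W"
proof (rule W_I)
  have "swap (swap t) = t" for t
    by (cases t rule: rev_cases) auto
  then show "bij swap"
    by (metis bij_iff)
  show "\<exists>d. swap (c # t) = d # swap t" for c t
    using swap_simps(2)[of "[]" c] swap_simps(2)[of "c # butlast t" "last t"]
    by (cases t rule: rev_cases) auto
qed simp

section \<open>Unique decomposition and first descendants\<close>

lemma pair_eq_iff: "pair u v = pair u' v' \<longleftrightarrow> u = u' \<and> v = v'"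
proof
  assume eq: "pair u v = pair u' v'"
  have "u t = u' t" "v t = v' t" for t
    using fun_cong[OF eq, of "t @ [False]"] fun_cong[OF eq, of "t @ [True]"] by auto
  then show "u = u' \<and> v = v'" by auto
qed simp

lemma pair_swap_eq_iff: "pair u v \<circ> swap = pair u' v' \<circ> swap \<longleftrightarrow> u = u' \<and> v = v'"
proof -
  have "surj swap"
    using swap_in_W by (simp add: W_iff bij_is_surj)
  then show ?thesis
    by (metis pair_eq_iff fun.map_cong0 surj_fun_eq)
qed

lemma pair_neq_pair_swap: "pair u v \<noteq> pair u' v' \<circ> swap"
  using pair_simps(2)[of u v "[]" False] swap_simps(2)[of "[]" False] pair_simps(2)[of u' v' "[]" True]
  by (metis append_eq_conv_conj comp_apply last_snoc)

lemma first_desc_pair: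
  assumes "d \<in> first_desc (pair u v)"
  shows "d = u \<or> d = v"
  using assms pair_neq_pair_swap by (auto simp: first_desc_def pair_eq_iff)

lemma first_desc_pair_swap:
  assumes "d \<in> first_desc (pair u v \<circ> swap)"
  shows "d = u \<circ> v"
  using assms pair_neq_pair_swap[symmetric] by (auto simp: first_desc_def pair_swap_eq_iff)

lemma nth_desc_path:
  assumes "w' \<in> nth_desc n w"
  obtains f where "f 0 = w" "f n = w'" "\<And>i. i < n \<Longrightarrow> f (Suc i) \<in> first_desc (f i)"
proof -
  have "\<exists>f. f 0 = w \<and> f n = w' \<and> (\<forall>i<n. f (Suc i) \<in> first_desc (f i))"
    using assms
  proof (induction n arbitrary: w')
    case 0
    then show ?case by auto
  next
    case (Suc n)
    then obtain w'' where w'': "w'' \<in> nth_desc n w" "w' \<in> first_desc w''"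
      by auto
    with Suc.IH obtain f where "f 0 = w" "f n = w''" "\<forall>i<n. f (Suc i) \<in> first_desc (f i)"
      by blast
    with w''(2) show ?case
      by (intro exI[of _ "f(Suc n := w')"]) (auto simp: less_Suc_eq)
  qed
  then show thesis using that by blast
qed

section \<open>Conjugacy in the automorphism group of the tree\<close>

text \<open>The action of \<open>w\<close> on the subtree at \<open>[c]\<close>, transported to the
  whole tree; the letter closest to the root is the last one, so \<open>butlast\<close> removes
  it.\<close>

definition subtree_map :: "bool \<Rightarrow> (vertex \<Rightarrow> vertex) \<Rightarrow> vertex \<Rightarrow> vertex" where
  "subtree_map c w t = butlast (w (t @ [c]))"

lemma subtree_map_simps [simp]:
  "subtree_map False (pair u v) = u" "subtree_map True (pair u v) = v"
  "subtree_map False (pair u v \<circ> swap) = v" "subtree_map True (pair u v \<circ> swap) = u"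
  by (auto simp: subtree_map_def)

text \<open>In the swapping case, \<open>(\<alpha>, \<beta>)\<close> conjugates \<open>(u', v') \<sigma>\<close> to \<open>(u, v) \<sigma>\<close> iff \<open>\<alpha> u' = u \<beta>\<close> and
  \<open>\<beta> v' = v \<alpha>\<close>; it suffices that \<open>\<alpha>\<close> conjugates \<open>u' v'\<close> to \<open>u v\<close> and that \<open>\<beta> = v \<alpha> v'\<^sup>-\<^sup>1\<close>.\<close>

primrec conjugator ::
    "(vertex \<Rightarrow> vertex) rel \<Rightarrow> nat \<Rightarrow>
     (vertex \<Rightarrow> vertex) \<Rightarrow> (vertex \<Rightarrow> vertex) \<Rightarrow> vertex \<Rightarrow> vertex" where
  "conjugator R 0 w w' = id"
| "conjugator R (Suc n) w w' =
    (let u = subtree_map False w; v = subtree_map True w;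
         u' = subtree_map False w'; v' = subtree_map True w' in
     if w [False] = [True] then
       let \<alpha> = conjugator R n (v \<circ> u) (v' \<circ> u') in pair \<alpha> (u \<circ> \<alpha> \<circ> inv\<^bsub>W\<^esub> u')
     else if (u, u') \<in> R \<and> (v, v') \<in> R then pair (conjugator R n u u') (conjugator R n v v')
     else pair (conjugator R n u v') (conjugator R n v u') \<circ> swap)"

text \<open>Only first descendants are compared. The crossed alternative is allowed because
  conjugation by \<open>swap\<close> exchanges the two components.\<close>

definition matching :: "(vertex \<Rightarrow> vertex) rel \<Rightarrow> (vertex \<Rightarrow> vertex) \<Rightarrow> (vertex \<Rightarrow> vertex) \<Rightarrow> bool" where
  "matching R w w' \<longleftrightarrow>
    (\<exists>u\<in>carrier W. \<exists>v\<in>carrier W. \<exists>u'\<in>carrier W. \<exists>v'\<in>carrier W.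
      w = pair u v \<and> w' = pair u' v' \<and> ((u, u') \<in> R \<and> (v, v') \<in> R \<or> (u, v') \<in> R \<and> (v, u') \<in> R) \<or>
      w = pair u v \<circ> swap \<and> w' = pair u' v' \<circ> swap \<and> (u \<circ> v, u' \<circ> v') \<in> R)"

definition bisimulation :: "(vertex \<Rightarrow> vertex) rel \<Rightarrow> bool" where
  "bisimulation R \<longleftrightarrow> (\<forall>(w, w')\<in>R. matching R w w')"

lemma matching_pair:
  assumes "u \<in> carrier W" "v \<in> carrier W" "u' \<in> carrier W" "v' \<in> carrier W"
    and "(u, u') \<in> R \<and> (v, v') \<in> R \<or> (u, v') \<in> R \<and> (v, u') \<in> R"
  shows "matching R (pair u v) (pair u' v')"
  unfolding matching_def using assms by blast

lemma matching_pair_swap: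
  assumes "u \<in> carrier W" "v \<in> carrier W" "u' \<in> carrier W" "v' \<in> carrier W"
    and "(u \<circ> v, u' \<circ> v') \<in> R"
  shows "matching R (pair u v \<circ> swap) (pair u' v' \<circ> swap)"
  unfolding matching_def using assms by blast

lemma bisimulationE [consumes 2, case_names straight crossed swapped]:
  assumes "bisimulation R" "(w, w') \<in> R"
  obtains
    (straight) u v u' v' where "u \<in> carrier W" "v \<in> carrier W" "u' \<in> carrier W" "v' \<in> carrier W"
      "w = pair u v" "w' = pair u' v'" "(u, u') \<in> R" "(v, v') \<in> R"
      "\<And>n. conjugator R (Suc n) w w' = pair (conjugator R n u u') (conjugator R n v v')"
  | (crossed) u v u' v' where "u \<in> carrier W" "v \<in> carrier W" "u' \<in> carrier W" "v' \<in> carrier W"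
      "w = pair u v" "w' = pair u' v'" "(u, v') \<in> R" "(v, u') \<in> R"
      "\<And>n. conjugator R (Suc n) w w' = pair (conjugator R n u v') (conjugator R n v u') \<circ> swap"
  | (swapped) u v u' v' where "u \<in> carrier W" "v \<in> carrier W" "u' \<in> carrier W" "v' \<in> carrier W"
      "w = pair u v \<circ> swap" "w' = pair u' v' \<circ> swap" "(u \<circ> v, u' \<circ> v') \<in> R"
      "\<And>n. conjugator R (Suc n) w w' = (let \<alpha> = conjugator R n (u \<circ> v) (u' \<circ> v') in
         pair \<alpha> (v \<circ> \<alpha> \<circ> inv\<^bsub>W\<^esub> v'))"
proof -
  have top: "pair u v [False] \<noteq> [True]" "(pair u v \<circ> swap) [False] = [True]" 
    if "u \<in> carrier W" "v \<in> carrier W" for u v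
    using pair_simps(2)[of u v "[]" False] pair_simps(2)[of u v "[]" True]
      swap_simps(2)[of "[]" False] that by (auto simp: W_iff)
  obtain u v u' v' where uv: "u \<in> carrier W" "v \<in> carrier W" "u' \<in> carrier W" "v' \<in> carrier W" and
    "w = pair u v \<and> w' = pair u' v' \<and> ((u, u') \<in> R \<and> (v, v') \<in> R \<or> (u, v') \<in> R \<and> (v, u') \<in> R) \<or>
      w = pair u v \<circ> swap \<and> w' = pair u' v' \<circ> swap \<and> (u \<circ> v, u' \<circ> v') \<in> R"
    using bspec[OF assms(1)[unfolded bisimulation_def] assms(2)] unfolding prod.case matching_def by meson
  then consider "w = pair u v" "w' = pair u' v'" "(u, u') \<in> R \<and> (v, v') \<in> R"
    | "w = pair u v" "w' = pair u' v'" "\<not> ((u, u') \<in> R \<and> (v, v') \<in> R)" "(u, v') \<in> R \<and> (v, u') \<in> R"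
    | "w = pair u v \<circ> swap" "w' = pair u' v' \<circ> swap" "(u \<circ> v, u' \<circ> v') \<in> R"
    by blast
  then show thesis
  proof cases
    case 1
    with uv top show thesis by (rule_tac straight[of u v u' v']) (simp_all add: Let_def)
  next
    case 2
    with uv top show thesis by (rule_tac crossed[of u v u' v']) (simp_all only: conjugator.simps Let_def subtree_map_simps if_False if_not_P)
  next
    case 3
    with uv top show thesis by (rule_tac swapped[of u v u' v']) (simp_all add: Let_def)
  qed
qed

lemma bisimulation_in_W:
  assumes "bisimulation R" "(w, w') \<in> R"
  shows "w \<in> carrier W" "w' \<in> carrier W"
  by (rule bisimulationE[OF assms]; simp only: pair_in_W comp_in_W swap_in_W)+

lemma conjugator_in_W:
  assumes "bisimulation R" "(w, w') \<in> R"
  shows "conjugator R n w w' \<in> carrier W"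
  using assms(2)
proof (induction n arbitrary: w w')
  case 0
  show ?case by (simp only: conjugator.simps id_in_W)
next
  case (Suc n)
  from assms(1) Suc.prems show ?case
  proof (cases rule: bisimulationE)
    case straight
    then show ?thesis using Suc.IH by (simp only: pair_in_W)
  next
    case crossed
    then show ?thesis using Suc.IH by (simp only: pair_in_W comp_in_W swap_in_W)
  next
    case swapped
    then show ?thesis using Suc.IH by (simp only: Let_def pair_in_W comp_in_W inv_in_W)
  qed
qed

lemma conjugator_intertwines:
  assumes "bisimulation R" "(w, w') \<in> R" "length t \<le> n"
  shows "conjugator R n w w' (w' t) = w (conjugator R n w w' t)"
  using assms(2,3)
proof (induction n arbitrary: w w' t)
  case 0
  then show ?case
    using bisimulation_in_W[OF assms(1) 0(1)] by (simp add: W_iff)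
next
  case (Suc n)
  show ?case
  proof (cases t rule: rev_cases)
    case Nil
    from assms(1) Suc.prems(1) show ?thesis
      by (cases rule: bisimulationE) (simp_all add: Nil Let_def del: conjugator.simps)
  next
    case (snoc t' c)
    with Suc.prems have t': "length t' \<le> n" by simp
    from assms(1) Suc.prems(1) show ?thesis
    proof (cases rule: bisimulationE)
      case (straight u v u' v')
      with Suc.IH[OF _ t'] snoc show ?thesis by (simp del: conjugator.simps)
    next
      case (crossed u v u' v')
      with Suc.IH[OF _ t'] snoc show ?thesis by (simp del: conjugator.simps)
    next
      case (swapped u v u' v')
      \<comment> \<open>Only words ending in \<open>True\<close> need the induction hypothesis. It
        concerns \<open>u' \<circ> v'\<close>, so \<open>t'\<close> is written as an image under
        \<open>v'\<close>.\<close>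
      define t'' where "t'' = (inv\<^bsub>W\<^esub> v') t'"
      have "t' = v' t''" "length t'' \<le> n"
        using t' swapped(4) by (simp_all add: t''_def inv_in_W W_length)
      let ?\<alpha> = "conjugator R n (u \<circ> v) (u' \<circ> v')"
      have "?\<alpha> ((u' \<circ> v') t'') = (u \<circ> v) (?\<alpha> t'')"
        by (rule Suc.IH) fact+
      then have IH: "?\<alpha> (u' (v' t'')) = u (v (?\<alpha> t''))"
        by simp
      have G: "conjugator R (Suc n) w w' = pair ?\<alpha> (v \<circ> ?\<alpha> \<circ> inv\<^bsub>W\<^esub> v')"
        by (simp only: swapped(8) Let_def)
      have w't: "w' t = (if c then u' t' else v' t') @ [\<not> c]"
        unfolding snoc swapped(6) by simp
      show ?thesis
        unfolding G w't unfolding swapped(5) snoc \<open>t' = v' t''\<close>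
        using IH by (simp add: inv_in_W(2)[OF swapped(4)])
    qed
  qed
qed

text \<open>Deeper truncations do not alter the levels already treated, so the truncations have a
  common limit.\<close>

lemma conjugator_coherent:
  assumes "bisimulation R" "(w, w') \<in> R" "length t \<le> n"
  shows "conjugator R (Suc n) w w' t = conjugator R n w w' t"
  using assms(2,3)
proof (induction n arbitrary: w w' t)
  case 0
  have "conjugator R (Suc 0) w w' [] = []"
    using conjugator_in_W[OF assms(1) 0(1)] by (metis W_iff)
  with 0 show ?case by simp
next
  case (Suc n)
  show ?case
  proof (cases t rule: rev_cases)
    case Nil
    from assms(1) Suc.prems(1) show ?thesis
      by (cases rule: bisimulationE) (simp_all add: Nil Let_def del: conjugator.simps)
  next
    case (snoc t' c)
    with Suc.prems have t': "length t' \<le> n" by simp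
    from assms(1) Suc.prems(1) show ?thesis
    proof (cases rule: bisimulationE)
      case (straight u v u' v')
      with Suc.IH[OF _ t'] snoc show ?thesis by (simp del: conjugator.simps)
    next
      case (crossed u v u' v')
      with Suc.IH[OF _ t'] snoc show ?thesis by (simp del: conjugator.simps)
    next
      case (swapped u v u' v')
      have "length ((inv\<^bsub>W\<^esub> v') t') \<le> n"
        using t' swapped(4) by (simp add: inv_in_W W_length)
      moreover have "conjugator R (Suc n) (u \<circ> v) (u' \<circ> v') t'' = conjugator R n (u \<circ> v) (u' \<circ> v') t''"
        if "length t'' \<le> n" for t''
        by (rule Suc.IH) fact+
      ultimately show ?thesis
        unfolding snoc swapped(8) Let_def using t' by (simp only: pair_simps comp_apply)
    qed
  qed
qed

lemma bisimilar_imp_conjugate: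
  assumes "bisimulation R" "(w, w') \<in> R"
  shows "\<exists>g\<in>carrier W. g \<circ> w' = w \<circ> g"
proof
  let ?G = "\<lambda>n. conjugator R n w w'"
  \<comment> \<open>The limit of the truncations: depth \<open>length t\<close> already decides the
    image of \<open>t\<close>.\<close>
  define g where "g t = ?G (length t) t" for t
  have G_eq: "?G n t = g t" if "length t \<le> n" for n t
    using that
  proof (induction n rule: dec_induct)
    case base
    then show ?case by (simp add: g_def)
  next
    case (step n)
    with conjugator_coherent[OF assms, of t n] show ?case by simp
  qed
  have G: "?G n \<in> carrier W" for n
    by (rule conjugator_in_W[OF assms])
  have len: "length (g t) = length t" for t
    using G by (simp add: g_def W_length)
  show "g \<in> carrier W"
  proof (rule W_I)
    show "bij g"
    proof (rule bijI)
      show "inj g"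
        by (rule injI) (metis G G_eq inv_in_W(2) len order_refl)
      show "surj g"
      proof (rule surjI)
        fix t
        let ?t = "(inv\<^bsub>W\<^esub> (?G (length t))) t"
        have "length ?t = length t"
          using G by (simp add: inv_in_W W_length)
        then show "g ?t = t"
          using inv_in_W(3)[OF G] by (simp add: g_def)
      qed
    qed
    show "g [] = []"
      using len by (metis length_0_conv)
    show "\<exists>d. g (c # t) = d # g t" for c t
      using W_child[OF G, of "Suc (length t)" c t] G_eq[of t "Suc (length t)"]
        G_eq[of "c # t" "Suc (length t)"] by simp
  qed
  show "g \<circ> w' = w \<circ> g"
    using conjugator_intertwines[OF assms] bisimulation_in_W(2)[OF assms] by (auto simp: g_def W_length)
qed
section \<open>Signs on the levels\<close>

text \<open>The permutation is the product of two disjoint transports of \<open>u\<close> and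
  \<open>v\<close>, and transport along an injection preserves signs.\<close>

lemma sign_on_two_copies:
  assumes "finite A" "inj_on f A" "inj_on g A" "f ` A \<inter> g ` A = {}"
    and "bij_betw u A A" "bij_betw v A A"
    and p: "\<And>a. a \<in> A \<Longrightarrow> p (f a) = f (u a)" "\<And>a. a \<in> A \<Longrightarrow> p (g a) = g (v a)"
  shows "sign_on (f ` A \<union> g ` A) p = sign_on A u * sign_on A v"
proof -
  let ?u = "restrict_id u A" and ?v = "restrict_id v A"
  let ?fu = "map_permutation A f ?u" and ?gv = "map_permutation A g ?v"
  have perm: "?u permutes A" "?v permutes A"
    using assms(5,6) by (auto intro: permutes_restrict_id)
  have "?fu permutes f ` A" "?gv permutes g ` A"
    using assms(2,3) perm by (auto intro!: map_permutation_permutes simp: bij_betw_def)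
  then have permutation: "permutation ?fu" "permutation ?gv"
    using assms(1) by (auto intro: permutes_imp_permutation finite_imageI)
  have mem: "u a \<in> A" "v a \<in> A" if "a \<in> A" for a
    using that assms(5,6) by (auto simp: bij_betw_def)
  have "restrict_id p (f ` A \<union> g ` A) y = (?fu \<circ> ?gv) y" for y
  proof -
    consider a where "a \<in> A" "y = f a" "f a \<notin> g ` A"
      | a where "a \<in> A" "y = g a" "g (v a) \<notin> f ` A" | "y \<notin> f ` A \<union> g ` A"
      using assms(4) mem by blast
    then show ?thesis
    proof cases
      case 1
      then show ?thesis
        using assms(2) p(1) by (simp add: map_permutation_def)
    next
      case 2
      then show ?thesis
        using assms(3) mem p(2) by (simp add: map_permutation_def)
    next
      case 3
      then show ?thesis by (simp add: map_permutation_def)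
    qed
  qed
  then have "restrict_id p (f ` A \<union> g ` A) = ?fu \<circ> ?gv" ..
  then have "sign_on (f ` A \<union> g ` A) p = sign (?fu \<circ> ?gv)"
    unfolding sign_on_def by (rule arg_cong)
  also have "\<dots> = sign ?u * sign ?v"
    using assms(1-3) perm permutation by (simp add: sign_compose sign_map_permutation)
  finally show ?thesis
    by (simp add: sign_on_def)
qed

abbreviation level :: "nat \<Rightarrow> vertex set" where
  "level n \<equiv> {t. length t = n}"

lemma finite_level: "finite (level n)"
  using finite_lists_length_eq[of "UNIV :: bool set" n] by simp

lemma level_Suc_append: "level (Suc n) = (\<lambda>t. t @ [False]) ` level n \<union> (\<lambda>t. t @ [True]) ` level n"
proof (intro equalityI subsetI)
  fix t assume "t \<in> level (Suc n)"
  then obtain t' c where "t = t' @ [c]" "length t' = n"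
    by (cases t rule: rev_cases) auto
  then show "t \<in> (\<lambda>t. t @ [False]) ` level n \<union> (\<lambda>t. t @ [True]) ` level n"
    by (cases c) auto
qed auto

lemma level_Suc_Cons: "level (Suc n) = Cons False ` level n \<union> Cons True ` level n"
proof (intro equalityI subsetI)
  fix t assume "t \<in> level (Suc n)"
  then obtain t' c where "t = c # t'" "length t' = n"
    by (cases t) auto
  then show "t \<in> Cons False ` level n \<union> Cons True ` level n"
    by (cases c) auto
qed auto

lemma W_bij_level:
  assumes "w \<in> carrier W"
  shows "bij_betw w (level n) (level n)"
  by (rule bij_betw_byWitness[where f' = "inv\<^bsub>W\<^esub> w"])
    (use assms in \<open>auto simp: inv_in_W W_length\<close>)

lemma level_sgn_comp:
  assumes "v \<in> carrier W" "w \<in> carrier W"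
  shows "level_sgn n (v \<circ> w) = level_sgn n v * level_sgn n w"
  unfolding level_sgn_def by (intro sign_on_compose W_bij_level assms finite_level)

lemma level_sgn_id [simp]: "level_sgn n id = 1"
  by (simp add: level_sgn_def)

lemma level_sgn_0:
  assumes "w \<in> carrier W"
  shows "level_sgn 0 w = 1"
proof -
  have "sign_on (level 0) w = sign_on (level 0) id"
    using assms by (intro sign_on_cong) (auto simp: W_iff)
  then show ?thesis by (simp add: level_sgn_def)
qed

lemma level_sgn_pair:
  assumes "u \<in> carrier W" "v \<in> carrier W"
  shows "level_sgn (Suc n) (pair u v) = level_sgn n u * level_sgn n v"
  unfolding level_sgn_def level_Suc_append
  by (rule sign_on_two_copies) (use assms in \<open>auto simp: inj_on_def finite_level W_bij_level\<close>)

lemma level_sgn_swap: "level_sgn (Suc n) swap = (if n = 0 then -1 else 1)"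
proof (cases n)
  case 0
  have level_1: "level (Suc 0) = {[False], [True]}"
    by (auto simp: length_Suc_conv)
  have "level_sgn (Suc 0) swap = sign_on {[False], [True]} (transpose [False] [True])"
    unfolding level_sgn_def level_1
  proof (rule sign_on_cong[OF refl])
    fix t assume "t \<in> {[False], [True]}"
    then show "swap t = transpose [False] [True] t"
      by (elim insertE emptyE) (simp_all add: swap_def)
  qed
  also have "\<dots> = -1"
    by (rule sign_on_transpose) simp_all
  finally show ?thesis using 0 by simp
next
  case (Suc m)
  \<comment> \<open>Beyond level one \<open>swap\<close> acts alike on the two copies given by the
    first letter, so its sign is a square.\<close>
  have "swap (c # t) = c # swap t" if "t \<in> level n" for c t
    using that Suc by (auto simp: swap_def)
  then have "level_sgn (Suc n) swap = level_sgn n swap * level_sgn n swap"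
    unfolding level_sgn_def level_Suc_Cons
    by (intro sign_on_two_copies finite_level W_bij_level swap_in_W) (auto simp: inj_on_def)
  also have "\<dots> = 1"
    unfolding level_sgn_def sign_on_def by (rule sign_idempotent)
  finally show ?thesis using Suc by simp
qed

section \<open>Words in the generators\<close>

lemma distinct_iff_count_list: "distinct xs \<longleftrightarrow> (\<forall>x. count_list xs x \<le> 1)"
proof (induction xs)
  case (Cons y xs)
  have "(\<forall>x. count_list (y # xs) x \<le> 1) \<longleftrightarrow> count_list xs y = 0 \<and> (\<forall>x. count_list xs x \<le> 1)"
    by (metis One_nat_def add_0 add_le_same_cancel2 count_list.simps(2) le_zero_eq zero_le_one)
  with Cons show ?case by (simp add: count_list_0_iff)
qed simp

lemma count_list_replicate: "count_list (replicate m y) x = (if x = y then m else 0)"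
  by (induction m) auto

text \<open>The parameter \<open>x\<close> stays general so that the constant choice
  \<open>False\<close> covers the elements \<open>a i\<close> as well.\<close>

locale tree_generators =
  fixes r s :: nat and x :: "nat \<Rightarrow> bool" and b :: "nat \<Rightarrow> vertex \<Rightarrow> vertex"
  assumes s_pos: "0 < s" and s_less: "s < r" and recursion: "b_recursion r s x b"
begin

lemma generator_in_W: "i \<in> {1..r} \<Longrightarrow> b i \<in> carrier W"
  using recursion by (simp add: b_recursion_def)

lemma generator_1: "b 1 = swap"
  using recursion by (simp add: b_recursion_def)

lemma generator_Suc_s: "b (Suc s) = (if x (Suc s) then pair (b s) (b r) else pair (b r) (b s))"
  using recursion by (simp add: b_recursion_def)

lemma generator_other:
  assumes "i \<in> {1..r}" "i \<noteq> 1" "i \<noteq> Suc s"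
  shows "b i = (if x i then pair id (b (i - 1)) else pair (b (i - 1)) id)"
proof -
  have "i \<in> {2..r} - {s + 1}"
    using assms by auto
  then show ?thesis
    using recursion unfolding b_recursion_def by blast
qed

definition word :: "nat list \<Rightarrow> vertex \<Rightarrow> vertex" where
  "word js = foldr (\<circ>) (map b js) id"

lemma word_Nil [simp]: "word [] = id"
  and word_Cons: "word (j # js) = b j \<circ> word js"
  by (simp_all add: word_def)

lemma word_single [simp]: "word [j] = b j"
  by (simp add: word_def)

lemma word_append: "word (js @ js') = word js \<circ> word js'"
  by (induction js) (simp_all add: word_Cons comp_assoc)

lemma word_in_W: "set js \<subseteq> {1..r} \<Longrightarrow> word js \<in> carrier W"
  by (induction js) (simp_all only: word_Nil word_Cons id_in_W comp_in_W generator_in_W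
      list.set insert_subset)

lemma word_root [simp]: "set js \<subseteq> {1..r} \<Longrightarrow> word js [] = []"
  using word_in_W by (simp add: W_iff)

text \<open>\<open>subtree_letter c j\<close> and \<open>subtree_word c js\<close> spell the action of \<open>b j\<close> and of \<open>word js\<close> on the
  subtree below the first-level vertex \<open>c\<close>; below it, \<open>word js\<close> acts rightmost letter first.\<close>

definition subtree_letter :: "bool \<Rightarrow> nat \<Rightarrow> nat list" where
  "subtree_letter c j =
    (if j = 1 then [] else if j = Suc s then [if c = x j then r else s]
     else if c = x j then [j - 1] else [])"

primrec subtree_word :: "bool \<Rightarrow> nat list \<Rightarrow> nat list" where
  "subtree_word c [] = []"
| "subtree_word c (j # js) =
    subtree_letter (c \<noteq> odd (count_list js 1)) j @ subtree_word c js"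

lemma generator_snoc:
  assumes "j \<in> {1..r}"
  shows "b j (t @ [c]) = word (subtree_letter c j) t @ [c \<noteq> (j = 1)]"
proof -
  consider "j = 1" | "j = Suc s" "j \<noteq> 1" | "j \<noteq> 1" "j \<noteq> Suc s"
    by blast
  then show ?thesis
  proof cases
    case 1
    then show ?thesis by (simp add: generator_1 [simplified] subtree_letter_def)
  next
    case 2
    then show ?thesis by (simp add: generator_Suc_s subtree_letter_def)
  next
    case 3
    then show ?thesis
      using generator_other[OF assms 3] by (simp add: subtree_letter_def)
  qed
qed

lemma word_snoc:
  assumes "set js \<subseteq> {1..r}"
  shows "word js (t @ [c]) = word (subtree_word c js) t @ [c \<noteq> odd (count_list js 1)]"
  using assms
proof (induction js)
  case (Cons j js)
  then show ?case
    using generator_snoc[of j] by (auto simp: word_Cons word_append)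
qed simp

lemma subtree_letter_letters: "j \<in> {1..r} \<Longrightarrow> set (subtree_letter c j) \<subseteq> {1..r}"
  using s_pos s_less by (auto simp: subtree_letter_def)

lemma subtree_word_letters: "set js \<subseteq> {1..r} \<Longrightarrow> set (subtree_word c js) \<subseteq> {1..r}"
  using subtree_letter_letters by (induction js) auto

lemma word_even:
  assumes "set js \<subseteq> {1..r}" "even (count_list js 1)"
  shows "word js = pair (word (subtree_word False js)) (word (subtree_word True js))"
  by (rule ext_snoc) (use assms in \<open>simp_all add: word_snoc\<close>)

text \<open>\<open>swap\<close> acts first, so words ending in \<open>False\<close> meet the second
  component; hence the reversed order.\<close>

lemma word_odd:
  assumes "set js \<subseteq> {1..r}" "odd (count_list js 1)"
  shows "word js = pair (word (subtree_word True js)) (word (subtree_word False js)) \<circ> swap"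
  by (rule ext_snoc) (use assms in \<open>simp_all add: word_snoc\<close>)

text \<open>Descent acts on spellings rather than on elements, because letters are to be counted.
  The order in the odd case is that of \<open>u \<circ> v\<close> for the components in
  \<open>word_odd\<close>.\<close>

definition word_desc :: "nat list \<Rightarrow> nat list \<Rightarrow> bool" where
  "word_desc js js' \<longleftrightarrow>
    (if odd (count_list js 1) then js' = subtree_word True js @ subtree_word False js
     else \<exists>c. js' = subtree_word c js)"

lemma word_desc_letters: "word_desc js js' \<Longrightarrow> set js \<subseteq> {1..r} \<Longrightarrow> set js' \<subseteq> {1..r}"
  using subtree_word_letters by (auto simp: word_desc_def split: if_splits)

lemma first_desc_word:
  assumes "set js \<subseteq> {1..r}" "d \<in> first_desc (word js)"
  shows "\<exists>js'. word_desc js js' \<and> word js' = d"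
proof (cases "odd (count_list js 1)")
  case True
  then show ?thesis
    using first_desc_pair_swap assms word_odd[OF assms(1)] by (auto simp: word_desc_def word_append)
next
  case False
  then have "d = word (subtree_word False js) \<or> d = word (subtree_word True js)"
    using first_desc_pair assms word_even[OF assms(1)] by metis
  with False show ?thesis
    by (auto simp: word_desc_def)
qed

text \<open>The recursion hands this property of \<open>swap\<close> on to all generators, by
  induction on the length of \<open>t\<close>. Hence words need no inverse letters.\<close>

lemma generator_involution: "i \<in> {1..r} \<Longrightarrow> b i (b i t) = t"
proof (induction t arbitrary: i rule: rev_induct)
  case Nil
  then show ?case using generator_in_W by (simp add: W_iff)
next
  case (snoc c t)
  consider "i = 1" | "i = Suc s" "i \<noteq> 1" | "i \<noteq> 1" "i \<noteq> Suc s"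
    by blast
  then show ?case
  proof cases
    case 1
    then show ?thesis by (simp add: generator_1 [simplified])
  next
    case 2
    then show ?thesis
      using snoc.IH[of s] snoc.IH[of r] s_pos s_less by (simp add: generator_Suc_s)
  next
    case 3
    with snoc.prems have "b (i - 1) (b (i - 1) t) = t"
      by (intro snoc.IH) auto
    then show ?thesis
      using generator_other[OF snoc.prems 3] by simp
  qed
qed

lemma generate_words:
  assumes "w \<in> generate W (b ` {1..r})"
  obtains js where "set js \<subseteq> {1..r}" "word js = w"
proof -
  have "\<exists>js. set js \<subseteq> {1..r} \<and> word js = w"
    using assms
  proof (induction rule: generate.induct)
    case one
    show ?case by (intro exI[of _ "[]"]) simp
  next
    case (incl h)
    then obtain i where "i \<in> {1..r}" "h = b i" by blast
    then show ?case by (intro exI[of _ "[i]"]) simp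
  next
    case (inv h)
    then obtain i where i: "i \<in> {1..r}" "h = b i" by blast
    have "b i \<circ> b i = id"
      using generator_involution[OF i(1)] by auto
    then have "inv\<^bsub>W\<^esub> b i = b i"
      using generator_in_W[OF i(1)] by (intro group.inv_equality[OF group_W]) simp_all
    with i show ?case by (intro exI[of _ "[i]"]) simp
  next
    case (eng h1 h2)
    then obtain js js' where "set js \<subseteq> {1..r}" "word js = h1" "set js' \<subseteq> {1..r}" "word js' = h2"
      by blast
    then show ?case by (intro exI[of _ "js @ js'"]) (simp add: word_append)
  qed
  then show thesis using that by blast
qed

text \<open>Signs of \<open>pair\<close> at level \<open>i + 1\<close> are products of component
  signs at level \<open>i\<close>, so the sign -1 of \<open>swap\<close> on level 1 moves up by one
  with each recursion. In \<open>b (s + 1)\<close> the component \<open>b r\<close> contributes 1,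
  since only its levels below \<open>r\<close> enter.\<close>

lemma level_sgn_generator:
  assumes "i \<in> {1..r}" "j \<in> {1..r}"
  shows "level_sgn i (b j) = (if i = j then -1 else 1)"
  using assms
proof (induction i arbitrary: j)
  case (Suc i)
  consider "j = 1" | "j \<noteq> 1" "i = 0" | "j = Suc s" "j \<noteq> 1" "i \<noteq> 0" | "j \<noteq> 1" "j \<noteq> Suc s" "i \<noteq> 0"
    by blast
  then show ?case
  proof cases
    case 1
    then show ?thesis by (simp add: generator_1 [simplified] level_sgn_swap)
  next
    case 2
    have "b j = pair (word (subtree_word False [j])) (word (subtree_word True [j]))"
      using word_even[of "[j]"] 2 Suc.prems by simp
    moreover have "word (subtree_word c [j]) \<in> carrier W" for c
      using Suc.prems by (intro word_in_W subtree_word_letters) simp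
    ultimately show ?thesis
      using 2 by (simp add: level_sgn_pair level_sgn_0)
  next
    case 3
    have "level_sgn i (b r) = 1" "level_sgn i (b s) = (if i = s then -1 else 1)"
      using Suc.IH[of r] Suc.IH[of s] Suc.prems 3 s_pos s_less by simp_all
    moreover have "b r \<in> carrier W" "b s \<in> carrier W"
      using s_pos s_less by (auto intro: generator_in_W)
    ultimately have "level_sgn (Suc i) (b (Suc s)) = (if i = s then -1 else 1)"
      by (cases "i = s") (simp_all add: generator_Suc_s level_sgn_pair)
    then show ?thesis
      using 3 by simp
  next
    case 4
    have "level_sgn i (b (j - 1)) = (if i = j - 1 then -1 else 1)"
      using Suc.prems 4 by (intro Suc.IH) auto
    moreover have "b (j - 1) \<in> carrier W"
      using Suc.prems 4 by (intro generator_in_W) auto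
    ultimately have "level_sgn (Suc i) (b j) = (if i = j - 1 then -1 else 1)"
      using generator_other[OF Suc.prems(2) 4(1,2)] id_in_W
      by (cases "i = j - 1") (simp_all add: level_sgn_pair)
    moreover have "i = j - 1 \<longleftrightarrow> Suc i = j"
      using Suc.prems by auto
    ultimately show ?thesis by simp
  qed
qed simp

lemma level_sgn_word:
  assumes "i \<in> {1..r}" "set js \<subseteq> {1..r}"
  shows "level_sgn i (word js) = (-1) ^ count_list js i"
  using assms(2)
proof (induction js)
  case (Cons j js)
  have "level_sgn i (word (j # js)) = level_sgn i (b j) * level_sgn i (word js)"
    unfolding word_Cons
    using Cons.prems by (intro level_sgn_comp generator_in_W word_in_W) simp_all
  with Cons show ?case
    using level_sgn_generator[OF assms(1), of j] by simp
qed simp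

text \<open>Through the signs, the parity of each letter depends on the element alone and not on its
  spelling.\<close>

lemma J_word: "set js \<subseteq> {1..r} \<Longrightarrow> J r (word js) = {i \<in> {1..r}. odd (count_list js i)}"
  unfolding J_def using level_sgn_word[of _ js] by (auto simp: minus_one_power_iff)

subsection \<open>Counting letters\<close>

text \<open>The only generator whose recursion has \<open>b i\<close> as a component;
  \<open>r\<close> and \<open>s\<close> share the parent \<open>s + 1\<close>.\<close>

definition parent :: "nat \<Rightarrow> nat" where
  "parent i = (if i = r then Suc s else Suc i)"

lemma count_subtree_letter:
  assumes "i \<in> {1..r}" "j \<in> {1..r}"
  shows "count_list (subtree_letter c j) i + count_list (subtree_letter (\<not> c) j) i =
    (if j = parent i then 1 else 0)"
proof -
  consider "j = 1" | "j = Suc s" "j \<noteq> 1" | "j \<noteq> 1" "j \<noteq> Suc s"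
    by blast
  then show ?thesis
  proof cases
    case 1
    with assms(1) s_pos show ?thesis by (simp add: subtree_letter_def parent_def)
  next
    case 2
    then have "count_list (subtree_letter c j) i + count_list (subtree_letter (\<not> c) j) i =
        count_list [r] i + count_list [s] i"
      by (cases "c = x j") (simp_all add: subtree_letter_def)
    moreover have "j = parent i \<longleftrightarrow> i = r \<or> i = s"
      using 2 by (auto simp: parent_def)
    ultimately show ?thesis
      using s_less by auto
  next
    case 3
    then have "count_list (subtree_letter c j) i + count_list (subtree_letter (\<not> c) j) i =
        count_list [j - 1] i"
      by (cases "c = x j") (simp_all add: subtree_letter_def)
    moreover have "j = parent i \<longleftrightarrow> j - 1 = i"
      using 3 assms by (auto simp: parent_def)
    ultimately show ?thesis by simp
  qed
qed

lemma count_subtree_word: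
  assumes "i \<in> {1..r}" "set js \<subseteq> {1..r}"
  shows "count_list (subtree_word c js) i + count_list (subtree_word (\<not> c) js) i =
    count_list js (parent i)"
  using assms(2)
proof (induction js)
  case (Cons j js)
  then show ?case
    using count_subtree_letter[OF assms(1), of j "c \<noteq> odd (count_list js 1)"] by auto
qed simp

text \<open>Each letter \<open>s + 1\<close> sends one \<open>s\<close> and one \<open>r\<close> to
  opposite subtrees, and no other letter yields either of them.\<close>

lemma count_subtree_word_s:
  assumes "set js \<subseteq> {1..r}"
  shows "count_list (subtree_word c js) s = count_list (subtree_word (\<not> c) js) r"
  using assms
proof (induction js)
  case (Cons j js)
  have "count_list (subtree_letter c j) s = count_list (subtree_letter (\<not> c) j) r" for c
    using Cons.prems s_pos s_less
    by (cases "c = x j"; cases "j = Suc s") (auto simp: subtree_letter_def)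
  with Cons show ?case by simp
qed simp

text \<open>The side \<open>\<not> c\<close> contains no \<open>r\<close>, so every
  \<open>s + 1\<close> puts its \<open>r\<close> on the side \<open>c\<close> and its
  \<open>s\<close> on the other.\<close>

lemma subtree_word_only_s:
  assumes "set js \<subseteq> {1..r}" "set (subtree_word (\<not> c) js) \<subseteq> {s}"
  shows "subtree_word (\<not> c) js = replicate (count_list js (Suc s)) s"
proof -
  let ?off = "subtree_word (\<not> c) js"
  have r: "r \<in> {1..r}" "r \<notin> set ?off"
    using s_less assms(2) by auto
  have "length ?off = count_list ?off s"
    using assms(2) by (subst count_list_eq_length_filter, subst filter_True) auto
  also have "\<dots> = count_list (subtree_word c js) r"
    using count_subtree_word_s[OF assms(1), of "\<not> c"] by simp
  also have "\<dots> = count_list js (Suc s)"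
    using count_subtree_word[OF r(1) assms(1), of c] r(2) by (simp add: parent_def)
  moreover have "replicate (length ?off) s = ?off"
    using assms(2) by (intro replicate_length_same) auto
  ultimately show ?thesis
    by metis
qed

definition heavy :: "nat list \<Rightarrow> nat" where
  "heavy js = length (filter (\<lambda>i. s < i) js)"

lemma heavy_append [simp]: "heavy (js @ js') = heavy js + heavy js'"
  by (simp add: heavy_def)

text \<open>The letter \<open>s + 1\<close> leaves one heavy letter \<open>r\<close>, a larger
  letter leaves one letter still above \<open>s\<close>, and small letters leave no heavy
  ones.\<close>

lemma heavy_subtree_word:
  assumes "set js \<subseteq> {1..r}"
  shows "heavy (subtree_word c js) + heavy (subtree_word (\<not> c) js) = heavy js"
  using assms
proof (induction js)
  case (Cons j js)
  have "heavy (subtree_letter c j) + heavy (subtree_letter (\<not> c) j) = heavy [j]" for c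
    using Cons.prems s_pos s_less
    by (cases "c = x j"; cases "j = Suc s") (auto simp: subtree_letter_def heavy_def)
  from this[of "c \<noteq> odd (count_list js 1)"] Cons show ?case
    using heavy_append[of "[j]" js] by simp
qed (simp add: heavy_def)

lemma subtree_word_without_1:
  "1 \<notin> set js \<Longrightarrow> subtree_word c js = concat (map (subtree_letter c) js)"
  by (induction js) (auto simp: count_list_0_iff)

lemma word_replicate: "i \<in> {1..r} \<Longrightarrow> word (replicate m i) = (if odd m then b i else id)"
  using generator_involution[of i] by (induction m) (auto simp: word_Cons)

end

section \<open>Periodic orbits of descendants\<close>

text \<open>The words \<open>V t\<close> spell successive descendants, chosen along an orbit that returns to its start
  after \<open>n\<close> steps; \<open>V 0\<close> has as few letters greater than \<open>s\<close> as possible. Since the descent never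
  increases the number of these letters, it is constant along the orbit.\<close>

locale word_orbit = tree_generators +
  fixes V :: "nat \<Rightarrow> nat list" and n :: nat
  assumes letters_0: "set (V 0) \<subseteq> {1..r}"
    and descent: "word_desc (V t) (V (Suc t))"
    and n_pos: "0 < n"
    and periodic: "word (V (t + n)) = word (V t)"
    and minimal: "set js \<subseteq> {1..r} \<Longrightarrow> word js = word (V 0) \<Longrightarrow> heavy (V 0) \<le> heavy js"
begin

lemma letters: "set (V t) \<subseteq> {1..r}"
proof (induction t)
  case (Suc t)
  then show ?case by (rule word_desc_letters[OF descent])
qed (rule letters_0)

definition swaps :: "nat \<Rightarrow> bool" where
  "swaps t \<longleftrightarrow> odd (count_list (V t) 1)"

text \<open>Swapping is thus a property of the element and hence periodic, although the spellings
  \<open>V t\<close> need not be.\<close>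

lemma swaps_iff: "swaps t \<longleftrightarrow> word (V t) [False] = [True]"
  using word_snoc[OF letters, of t "[]" False] subtree_word_letters[OF letters]
  by (simp add: swaps_def)

lemma descent_swap: "swaps t \<Longrightarrow> V (Suc t) = subtree_word True (V t) @ subtree_word False (V t)"
  using descent[of t] by (simp add: word_desc_def swaps_def)

lemma descent_pair:
  assumes "\<not> swaps t"
  obtains c where "V (Suc t) = subtree_word c (V t)"
  using descent[of t] assms by (auto simp: word_desc_def swaps_def)

lemma periodic_mult: "word (V (t + k * n)) = word (V t)"
proof (induction k)
  case (Suc k)
  have "word (V (t + Suc k * n)) = word (V (t + k * n + n))"
    by (simp add: algebra_simps)
  with Suc periodic show ?case by simp
qed simp

lemma heavy_descent: "heavy (V (Suc t)) \<le> heavy (V t)"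
proof (cases "swaps t")
  case True
  then show ?thesis
    using heavy_subtree_word[OF letters, of True t] by (simp add: descent_swap)
next
  case False
  then obtain c where "V (Suc t) = subtree_word c (V t)"
    by (rule descent_pair)
  then show ?thesis
    using heavy_subtree_word[OF letters, of c t] by simp
qed

lemma heavy_constant: "heavy (V t) = heavy (V 0)"
proof (rule antisym)
  have antimono: "i \<le> j \<Longrightarrow> heavy (V j) \<le> heavy (V i)" for i j
    by (rule lift_Suc_antimono_le[of "\<lambda>t. heavy (V t)"]) (rule heavy_descent)
  show "heavy (V t) \<le> heavy (V 0)"
    by (rule antimono) simp
  \<comment> \<open>The time \<open>t * n\<close> is a multiple of the period, where minimality
    applies, and it does not precede \<open>t\<close>.\<close>
  have "heavy (V 0) \<le> heavy (V (t * n))"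
    using periodic_mult[of 0 t] by (intro minimal letters) simp
  also have "\<dots> \<le> heavy (V t)"
    using n_pos by (intro antimono) simp
  finally show "heavy (V 0) \<le> heavy (V t)" .
qed

text \<open>The two sides share out the heavy letters, and the path keeps all of them.\<close>

lemma heavy_off_path:
  assumes "V (Suc t) = subtree_word c (V t)"
  shows "heavy (subtree_word (\<not> c) (V t)) = 0"
  using heavy_subtree_word[OF letters, of c t] heavy_constant[of t] heavy_constant[of "Suc t"] assms
  by simp

text \<open>The bound sets \<open>r\<close> apart, whose parent is \<open>s + 1\<close>.\<close>

lemma letter_parent:
  assumes "i \<in> set (V (Suc t))" "i < r"
  shows "Suc i \<in> set (V t)"
proof -
  have i: "i \<in> {1..r}"
    using assms(1) letters by blast
  have "count_list (V (Suc t)) i \<le> count_list (V t) (parent i)"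
  proof (cases "swaps t")
    case True
    then show ?thesis
      using count_subtree_word[OF i letters, of True t] by (simp add: descent_swap)
  next
    case False
    then obtain c where "V (Suc t) = subtree_word c (V t)"
      by (rule descent_pair)
    then show ?thesis
      using count_subtree_word[OF i letters, of c t] by simp
  qed
  moreover have "count_list (V (Suc t)) i \<noteq> 0"
    using assms(1) by (simp add: count_list_0_iff)
  ultimately have "count_list (V t) (Suc i) \<noteq> 0"
    using assms(2) by (simp add: parent_def)
  then show ?thesis by (simp add: count_list_0_iff)
qed

lemma letter_ancestor: "i \<in> set (V (t + k)) \<Longrightarrow> i + k \<le> r \<Longrightarrow> i + k \<in> set (V t)"
proof (induction k arbitrary: i)
  case (Suc k)
  then have "Suc i \<in> set (V (t + k))"
    by (intro letter_parent) simp_all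
  with Suc.IH[of "Suc i"] Suc.prems show ?case by simp
qed simp

text \<open>Letters at most \<open>s\<close> ultimately come from \<open>s + 1\<close>. At a non-swapping step the companion \<open>r\<close> of
  a newborn \<open>s\<close> lies on the other side, hence by minimality on the path, so \<open>s\<close> is off the path.\<close>

lemma s_born:
  assumes "s \<in> set (V (Suc t))"
  shows "swaps t"
proof (rule ccontr)
  assume "\<not> swaps t"
  then obtain c where c: "V (Suc t) = subtree_word c (V t)"
    by (rule descent_pair)
  have "r \<notin> set (subtree_word (\<not> c) (V t))"
    using heavy_off_path[OF c] s_less by (auto simp: heavy_def filter_empty_conv)
  then have "count_list (subtree_word c (V t)) s = 0"
    using count_subtree_word_s[OF letters, of c t] by (simp add: count_list_0_iff)
  with c assms show False by (simp add: count_list_0_iff)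
qed

text \<open>Tracing \<open>i\<close> back for \<open>s - i\<close> steps gives a letter
  \<open>s\<close>; one more step leads to its birth, where the path swaps.\<close>

lemma small_letter_origin:
  assumes "i \<in> set (V (t + (Suc s - i)))" "i \<le> s"
  shows "swaps t"
proof -
  have "i \<in> set (V (Suc t + (s - i)))"
    using assms by (simp add: Suc_diff_le)
  then have "i + (s - i) \<in> set (V (Suc t))"
    using assms s_less by (intro letter_ancestor) simp_all
  with assms(2) show ?thesis by (intro s_born) simp
qed

lemma swaps_1: "swaps t \<Longrightarrow> 1 \<in> set (V t)"
  unfolding swaps_def using count_list_0_iff[of "V t" 1] by fastforce

text \<open>A letter 1 at time \<open>t + s\<close> stems from an \<open>s\<close> born at step
  \<open>t\<close>, so swaps pass backwards by \<open>s\<close>. Advancing by \<open>s\<close>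
  periods and then returning \<open>n - 1\<close> times by \<open>s\<close> gives the forward
  direction.\<close>

lemma swaps_add_s: "swaps (t + s) \<longleftrightarrow> swaps t"
proof
  have step_back: "swaps t" if "swaps (t + s)" for t
    using small_letter_origin[of 1 t] swaps_1[OF that] s_pos by simp
  then show "swaps (t + s) \<Longrightarrow> swaps t" .
  have steps_back: "swaps t" if "swaps (t + k * s)" for t k
    using that
  proof (induction k)
    case (Suc k)
    then have "swaps ((t + k * s) + s)" by (simp add: algebra_simps)
    with step_back Suc.IH show ?case by blast
  qed simp
  assume "swaps t"
  then have "swaps (t + s * n)"
    using periodic_mult[of t s] by (simp add: swaps_iff)
  moreover have "t + s * n = (t + s) + (n - 1) * s"
    using n_pos by (cases n) (simp_all add: algebra_simps)
  ultimately show "swaps (t + s)"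
    using steps_back[of "t + s" "n - 1"] by simp
qed

text \<open>From time \<open>s\<close> on, a letter 1 was born along the path, not inherited from
  \<open>V 0\<close>, so a swap took place \<open>s\<close> steps earlier.\<close>

lemma only_swaps_1:
  assumes "1 \<in> set (V t)" "s \<le> t"
  shows "swaps t"
proof -
  obtain t' where t': "t = t' + s"
    using assms(2) by (metis le_add_diff_inverse2)
  with assms(1) have "swaps t'"
    using s_pos by (intro small_letter_origin[of 1]) simp_all
  with t' show ?thesis by (simp add: swaps_add_s)
qed

text \<open>A letter \<open>2 \<le> i \<le> s\<close> on the path was born when the path swapped, so the path swaps again when it
  has become \<open>1\<close>; hence some letter \<open>i\<close> stays on the path until then, and with it all letters \<open>i\<close>.\<close>

lemma off_path_word:
  assumes "\<not> swaps t" "s \<le> t" "V (Suc t) = subtree_word c (V t)"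
  shows "subtree_word (\<not> c) (V t) = replicate (count_list (V t) (Suc s)) s"
proof -
  let ?off = "subtree_word (\<not> c) (V t)"
  have one: "1 \<notin> set (V t)"
    using only_swaps_1 assms by blast
  show ?thesis
  proof (rule subtree_word_only_s[OF letters], rule subsetI, rule ccontr)
    fix j assume j: "j \<in> set ?off" and "j \<notin> {s}"
    then have "j \<noteq> s" by simp

    have "j \<le> s"
      using heavy_off_path[OF assms(3)] j by (auto simp: heavy_def filter_empty_conv not_less)
    with \<open>j \<noteq> s\<close> have "j < s" by simp
    have "j \<ge> 1"
      using j subtree_word_letters[OF letters] by fastforce
    obtain i where i: "i \<in> set (V t)" "j \<in> set (subtree_letter (\<not> c) i)"
      using j one by (auto simp: subtree_word_without_1)
    then have i_j: "i = Suc j" "(\<not> c) = x i"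
      using \<open>j < s\<close> \<open>j \<ge> 1\<close> s_less by (auto simp: subtree_letter_def split: if_splits)
    define t' where "t' = t - (Suc s - i)"
    have "t = t' + (Suc s - i)"
      using assms(2) \<open>j \<ge> 1\<close> i_j(1) by (simp add: t'_def)
    with i(1) \<open>j < s\<close> i_j(1) have "swaps t'"
      by (intro small_letter_origin[of i]) simp_all
    then have "swaps (t' + s)"
      by (simp add: swaps_add_s)
    \<comment> \<open>The shift by \<open>s\<close> of the birth step of \<open>i\<close> is the
      time at which a letter \<open>j\<close> of \<open>V (Suc t)\<close> would have become
      1.\<close>
    moreover have "t' + s = Suc t + (j - 1)"
      using \<open>t = t' + (Suc s - i)\<close> \<open>j < s\<close> \<open>j \<ge> 1\<close> i_j(1) by simp
    ultimately have "1 \<in> set (V (Suc t + (j - 1)))"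
      using swaps_1 by metis
    then have "1 + (j - 1) \<in> set (V (Suc t))"
      using \<open>j < s\<close> s_less by (intro letter_ancestor) simp_all
    then have "j \<in> set (subtree_word c (V t))"
      using \<open>j \<ge> 1\<close> assms(3) by simp
    \<comment> \<open>This \<open>j\<close> on the path also stems from \<open>Suc j\<close>, but a
      step without letters 1 sends all copies of \<open>Suc j\<close> to the same side.\<close>
    then obtain i' where "i' \<in> set (V t)" "j \<in> set (subtree_letter c i')"
      using one by (auto simp: subtree_word_without_1)
    then have "i' = Suc j" "c = x i'"
      using \<open>j < s\<close> \<open>j \<ge> 1\<close> s_less by (auto simp: subtree_letter_def split: if_splits)
    with i_j show False by simp
  qed
qed

end

lemma (in tree_generators) Phi_irreducible_word_orbit:
  assumes "w \<in> generate W (b ` {1..r})" "Phi_irreducible w"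
  obtains V n where "word_orbit r s x b V n" "word (V 0) = w"
proof -
  obtain n where n: "n \<ge> 1" "w \<in> nth_desc n w"
    using assms(2) by (auto simp: Phi_irreducible_def Desc_def)
  then obtain p where p: "p 0 = w" "p n = w" "\<And>i. i < n \<Longrightarrow> p (Suc i) \<in> first_desc (p i)"
    using nth_desc_path by metis
  \<comment> \<open>The closed chain from \<open>w\<close> to \<open>w\<close>, repeated
    forever.\<close>
  define f where "f t = p (t mod n)" for t
  have f: "f (Suc t) \<in> first_desc (f t)" for t
    using p(3)[of "t mod n"] p(1,2) n(1) by (auto simp: f_def mod_Suc)
  define spells where "spells js \<longleftrightarrow> set js \<subseteq> {1..r} \<and> word js = w" for js
  have "\<exists>js. spells js"
    using generate_words[OF assms(1)] unfolding spells_def by metis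
  then obtain V0 where V0: "spells V0" "\<And>js. spells js \<Longrightarrow> heavy V0 \<le> heavy js"
    using ex_has_least_nat[of spells _ heavy] by blast
  obtain V where V: "V 0 = V0" "\<And>t. set (V t) \<subseteq> {1..r} \<and> word (V t) = f t"
      "\<And>t. word_desc (V t) (V (Suc t))"
  proof -
    \<comment> \<open>The first clause forces the choice of spellings to start from the minimal
      one.\<close>
    let ?P = "\<lambda>t js. (t = 0 \<longrightarrow> js = V0) \<and> set js \<subseteq> {1..r} \<and> word js = f t"
    have step: "\<exists>js'. ?P (Suc t) js' \<and> word_desc js js'" if "?P t js" for js t
      using first_desc_word[of js "f (Suc t)"] word_desc_letters f[of t] that
      by (metis nat.distinct(1))
    have "?P 0 V0"
      using V0(1) p(1) by (simp add: spells_def f_def)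
    then have "\<exists>V. \<forall>t. ?P t (V t) \<and> word_desc (V t) (V (Suc t))"
      using dependent_nat_choice[of ?P "\<lambda>_. word_desc", OF _ step] by blast
    then show thesis
      using that by blast
  qed
  have "word_orbit r s x b V n"
  proof unfold_locales
    show "set (V 0) \<subseteq> {1..r}" and "word_desc (V t) (V (Suc t))"
      and "word (V (t + n)) = word (V t)" and "0 < n" for t
      using V(2,3) n(1) by (simp_all add: f_def)
    show "heavy (V 0) \<le> heavy js" if "set js \<subseteq> {1..r}" "word js = word (V 0)" for js
      using V0 V(1) that by (simp add: spells_def)
  qed
  moreover have "word (V 0) = w"
    using V(2)[of 0] p(1) by (simp add: f_def)
  ultimately show thesis by (rule that)
qed

section \<open>Conjugacy of irreducible elements\<close>

lemma pair_id_id: "pair id id = id"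
  by (rule ext_snoc) simp_all

text \<open>The order of \<open>js\<close> is left free, since only parities have to agree, and
  \<open>s \<le> t\<close> makes \<open>off_path_word\<close> available. The other pairs in
  \<open>R\<close> serve the components off the path and their descendants.\<close>

lemma (in word_orbit) orbit_bisimulation:
  assumes "a_recursion r s a"
  defines "R \<equiv> {(word (V t), foldr (\<circ>) (map a js) id) | t js. s \<le> t \<and> distinct js \<and>
    set js = {i \<in> {1..r}. odd (count_list (V t) i)}} \<union> {(b i, a i) | i. i \<in> {1..s}} \<union> {(id, id)}"
  shows "bisimulation R"
proof -
  interpret A: tree_generators r s "\<lambda>_. False" a
    using s_pos s_less assms(1) by unfold_locales (simp_all add: a_recursion_eq)
  have id_R: "(id, id) \<in> R" and generator_R: "i \<in> {1..s} \<Longrightarrow> (b i, a i) \<in> R" for i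
    by (auto simp: R_def)
  have orbit_R: "(word (V t), A.word js) \<in> R"
    if "s \<le> t" "set js \<subseteq> {1..r}" "\<And>i. i \<in> {1..r} \<Longrightarrow> count_list js i \<le> 1"
      "\<And>i. i \<in> {1..r} \<Longrightarrow> odd (count_list js i) \<longleftrightarrow> odd (count_list (V t) i)" for t js
  proof -
    have "i \<in> set js \<longleftrightarrow> odd (count_list js i)" if "i \<in> {1..r}" for i
      using \<open>\<And>i. i \<in> {1..r} \<Longrightarrow> count_list js i \<le> 1\<close>[OF that] count_list_0_iff[of js i]
      by (cases "count_list js i") auto
    then have "set js = {i \<in> {1..r}. odd (count_list (V t) i)}"
      using that(2,4) by blast
    moreover have "distinct js"
      unfolding distinct_iff_count_list using that(2,3) by (metis count_notin subsetD zero_le_one)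
    ultimately show ?thesis
      using that(1) unfolding R_def A.word_def by blast
  qed
  have orbit: "matching R (word (V t)) (A.word js)"
    if t: "s \<le> t" and js: "distinct js" "set js = {i \<in> {1..r}. odd (count_list (V t) i)}" for t js
  proof -
    have js_letters: "set js \<subseteq> {1..r}"
      using js(2) by blast
    have count_le: "count_list js i \<le> 1" for i
      using js(1) by (simp add: distinct_iff_count_list)
    have parity: "odd (count_list js i) \<longleftrightarrow> odd (count_list (V t) i)" if "i \<in> {1..r}" for i
    proof -
      have "odd (count_list js i) \<longleftrightarrow> i \<in> set js"
        using count_le[of i] count_list_0_iff[of js i] by (cases "count_list js i") auto
      with js(2) that show ?thesis by blast
    qed
    have parent: "parent i \<in> {1..r}" if "i \<in> {1..r}" for i
      using that s_less by (auto simp: parent_def)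
    have one: "1 \<in> {1..r}" and s: "s \<in> {1..s}" "s \<in> {1..r}" and Suc_s: "Suc s \<in> {1..r}"
      using s_pos s_less by auto
    have W: "word (subtree_word c (V t)) \<in> carrier W" "A.word (A.subtree_word c js) \<in> carrier W" for c
      by (intro word_in_W A.word_in_W subtree_word_letters A.subtree_word_letters letters js_letters)+
    show ?thesis
    proof (cases "swaps t")
      case True
      then have odd: "odd (count_list (V t) 1)" "odd (count_list js 1)"
        using parity[OF one] by (simp_all add: swaps_def)
      \<comment> \<open>A swap gathers both sides, so every count is inherited from the parent
        letter; the bound 1 and the parities persist.\<close>
      let ?js = "A.subtree_word True js @ A.subtree_word False js"
      have count: "count_list ?js i = count_list js (parent i)"
        "count_list (V (Suc t)) i = count_list (V t) (parent i)" if "i \<in> {1..r}" for i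
        using A.count_subtree_word[OF that js_letters, of True]
          count_subtree_word[OF that letters, of True t] True by (simp_all add: descent_swap)
      have "(word (V (Suc t)), A.word ?js) \<in> R"
        using t count count_le parity parent A.subtree_word_letters[OF js_letters]
        by (intro orbit_R) (simp_all del: count_list_append)
      then show ?thesis
        unfolding word_odd[OF letters odd(1)] A.word_odd[OF js_letters odd(2)]
        using True by (intro matching_pair_swap W) (simp add: descent_swap word_append A.word_append)
    next
      case False
      then have even: "even (count_list (V t) 1)" "even (count_list js 1)"
        using parity[OF one] by (simp_all add: swaps_def)
      obtain c where c: "V (Suc t) = subtree_word c (V t)"
        using False by (rule descent_pair)
      \<comment> \<open>For the \<open>a i\<close>, letters other than 1 send everything to the
        \<open>False\<close> side except the \<open>s\<close> born from \<open>s + 1\<close>, so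
        this side corresponds to the path.\<close>
      let ?on = "A.subtree_word False js" and ?off = "A.subtree_word True js"
      have off: "subtree_word (\<not> c) (V t) = replicate (count_list (V t) (Suc s)) s"
        by (rule off_path_word) fact+
      have "1 \<notin> set js"
        using even(2) count_le[of 1] count_list_0_iff[of js 1] by (cases "count_list js 1") auto
      then have "set ?off \<subseteq> {s}"
        by (auto simp: A.subtree_word_without_1 A.subtree_letter_def split: if_splits)
      then have off': "?off = replicate (count_list js (Suc s)) s"
        using A.subtree_word_only_s[OF js_letters, of False] by simp
      have off_R: "(word (subtree_word (\<not> c) (V t)), A.word ?off) \<in> R"
        using parity[OF Suc_s] id_R generator_R[OF s(1)]
        by (simp add: off off' word_replicate[OF s(2)] A.word_replicate[OF s(2)])
      \<comment> \<open>All newborn \<open>s\<close> lie off the path, so on it \<open>s\<close> is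
        absent and every other count is that of the parent.\<close>
      have count: "count_list ?on i = (if i = s then 0 else count_list js (parent i))"
        "count_list (V (Suc t)) i = (if i = s then 0 else count_list (V t) (parent i))"
        if "i \<in> {1..r}" for i
        using A.count_subtree_word[OF that js_letters, of False]
          count_subtree_word[OF that letters, of c t] s_less
        by (auto simp: c off off' count_list_replicate parent_def)
      have on_R: "(word (subtree_word c (V t)), A.word ?on) \<in> R"
        unfolding c[symmetric]
        using t count count_le parity parent A.subtree_word_letters[OF js_letters]
        by (intro orbit_R) simp_all
      \<comment> \<open>The path of the \<open>b i\<close> may take either side, that of the
        \<open>a i\<close> takes \<open>False\<close>; the choice \<open>c = True\<close> calls for
        the crossed match.\<close>
      show ?thesis
        unfolding word_even[OF letters even(1)] A.word_even[OF js_letters even(2)]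
        using on_R off_R by (intro matching_pair W) (cases c; simp)
    qed
  qed
  have generator: "matching R (b i) (a i)" if i: "i \<in> {1..s}" for i
  proof (cases "i = 1")
    case True
    have "matching R (pair id id \<circ> swap) (pair id id \<circ> swap)"
      using id_R by (intro matching_pair_swap id_in_W) simp
    then show ?thesis
      using True generator_1 A.generator_1 by (simp add: pair_id_id)
  next
    case False
    with i s_less have "i - 1 \<in> {1..s}" "i - 1 \<in> {1..r}" "i \<in> {1..r}" "i \<noteq> Suc s"
      by auto
    then show ?thesis
      using generator_other[of i] A.generator_other[of i] False id_R generator_R[of "i - 1"]
        generator_in_W[of "i - 1"] A.generator_in_W[of "i - 1"] id_in_W
      by (auto intro!: matching_pair)
  qed
  have "matching R id id"
    using matching_pair[OF id_in_W id_in_W id_in_W id_in_W, of R] id_R by (simp add: pair_id_id)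
  then show ?thesis
    unfolding bisimulation_def using orbit generator by (auto simp: R_def A.word_def)
qed

theorem proposition5p30:
  fixes r s :: nat and x :: "nat \<Rightarrow> bool"
    and a b :: "nat \<Rightarrow> vertex \<Rightarrow> vertex"
    and w :: "vertex \<Rightarrow> vertex" and ks :: "nat list"
  assumes "0 < s" and "s < r"
    and "b_recursion r s x b"
    and "a_recursion r s a"
    and "w \<in> generate W (b ` {1..r})"
    and "Phi_irreducible w"
    and "distinct ks" and "set ks = J r w"
  shows "\<exists>g\<in>carrier W.
    w = g \<otimes>\<^bsub>W\<^esub> foldr (\<otimes>\<^bsub>W\<^esub>) (map a ks) \<one>\<^bsub>W\<^esub> \<otimes>\<^bsub>W\<^esub> inv\<^bsub>W\<^esub> g"
proof -
  interpret tree_generators r s x b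
    by unfold_locales fact+
  obtain V n where "word_orbit r s x b V n" and V_0: "word (V 0) = w"
    using Phi_irreducible_word_orbit[OF assms(5,6)] .
  then interpret word_orbit r s x b V n by simp
  let ?a = "foldr (\<circ>) (map a ks) id"
  \<comment> \<open>The time \<open>s * n\<close> is a multiple of the period, so the orbit is back
    at \<open>w\<close>, and it is at least \<open>s\<close>, as the bisimulation requires.\<close>
  have w: "w = word (V (s * n))"
    using periodic_mult[of 0 s] V_0 by simp
  have "set ks = {i \<in> {1..r}. odd (count_list (V (s * n)) i)}"
    unfolding assms(8) w by (rule J_word[OF letters])
  moreover have "s \<le> s * n"
    using n_pos by simp
  ultimately obtain g where g: "g \<in> carrier W" "g \<circ> ?a = w \<circ> g"
    using bisimilar_imp_conjugate[OF orbit_bisimulation[OF assms(4)], of w ?a] assms(7) w by blast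
  have "g (?a ((inv\<^bsub>W\<^esub> g) t)) = w t" for t
    using fun_cong[OF g(2), of "(inv\<^bsub>W\<^esub> g) t"] by (simp add: inv_in_W g(1))
  then have "w = g \<circ> ?a \<circ> inv\<^bsub>W\<^esub> g"
    by auto
  with g(1) show ?thesis by auto
qed

end
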